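(* Let $G$ be a finite simple undirected graph with $N$ nodes whose vertex set is partitioned as $V=\bigcup_{k=1}^{l}V_k$ into the vertex sets $V_1,\dots,V_l$ of its (disjoint) connected components, and let $\{Z(t)\}$ be the heat diffusion process on $G$ with initial distribution $p(0)$. Then $$\lim_{t\to\infty}H(Z(t)\mid Z(0))=\sum_{k=1}^{l}\log(|V_k|)\sum_{j\in V_k}p_j(0),$$ and if the initial distribution $p(0)$ is uniform on $V$, then $$\lim_{t\to\infty}H(Z(t)\mid Z(0))=\sum_{i=1}^{l}\frac{|V_i|}{N}\log(|V_i|).$$
   Context: The combinatorial Laplacian $\mathbf{L}$ of a graph has entries $L_{i,i}=d_i$ (the degree of node $i$), $L_{i,j}=-1$ if $i\neq j$ and $i,j$ are joined by an edge, and $L_{i,j}=0$ otherwise. Heat diffusion is the continuous-time homogeneous Markov chain on the nodes whose probability vector satisfies $\frac{d}{dt}\mathbf{p}^{\intercal}(t)=-\mathbf{p}^{\intercal}(t)\mathbf{L}$ (diffusion rate equal to 1), so its transition matrix from time $0$ to time $t$ is $\mathbf{T}(0,t)=e^{-t\mathbf{L}}$. The conditional entropy is $H(Z(t)\mid Z(0))=\sum_i p_i(0)H_i(t\mid 0)$, where $p_i(0)$ is the probability that $Z(0)$ is node $i$ and $H_i(t\mid 0)=-\sum_j T_{i,j}(0,t)\log T_{i,j}(0,t)$. Logarithms are natural and $0\log 0=0$. *)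

theory Defs
  imports "HOL-Probability.Probability" "Graph_Theory.Digraph_Component"
begin

text \<open>
  A finite simple undirected graph is a \<^locale>\<open>pair_graph\<close>: a finite, loop-free, symmetric digraph
  whose arcs are pairs of vertices, an edge being represented by its two orientations.  Hence the
  degree of a vertex is its out-degree, and the vertex sets of the connected components are those
  of the strongly connected components.  So that the library matrices can be indexed by the nodes,
  the node set is the universe of a finite type.
\<close>

definition laplacian :: "'n::finite pair_pre_digraph \<Rightarrow> real ^ 'n ^ 'n" where
  "laplacian G = (\<chi> i j. if i = j then real (out_degree (with_proj G) i)
                         else if (i, j) \<in> parcs G then - 1 else 0)"

text \<open>
  The ring multiplication on vectors is componentwise, so neither \<open>exp\<close> nor \<open>^\<close> gives the
  matrix exponential or matrix powers.
\<close>

definition matrix_power :: "real ^ 'n ^ 'n \<Rightarrow> nat \<Rightarrow> real ^ 'n ^ 'n" where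
  "matrix_power A k = (((**) A) ^^ k) (mat 1)"

definition matrix_exp :: "real ^ 'n ^ 'n \<Rightarrow> real ^ 'n ^ 'n" where
  "matrix_exp A = (\<Sum>k. (1 / fact k) *\<^sub>R matrix_power A k)"

definition heat_kernel :: "'n::finite pair_pre_digraph \<Rightarrow> real \<Rightarrow> real ^ 'n ^ 'n" where
  "heat_kernel G t = matrix_exp ((- t) *\<^sub>R laplacian G)"

text \<open>
  In a homogeneous chain the transition matrix from time \<open>s\<close> to time \<open>t \<ge> s\<close> is \<open>T (t - s)\<close>.  The
  Markov property is stated in product form, which needs no conditioning on null events: given the
  states \<open>x 0, \<dots>, x m\<close> at the times \<open>s 0 \<le> \<dots> \<le> s m\<close>, the probability of state
  \<open>x (Suc m)\<close> at time \<open>s (Suc m)\<close> is the entry of the transition matrix at \<open>x m\<close> and \<open>x (Suc m)\<close>.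
\<close>

definition homogeneous_markov_chain ::
  "'w measure \<Rightarrow> (real \<Rightarrow> 'w \<Rightarrow> 'n::finite) \<Rightarrow> (real \<Rightarrow> real ^ 'n ^ 'n) \<Rightarrow> bool" where
  "homogeneous_markov_chain M Z T \<longleftrightarrow>
     prob_space M \<and>
     (\<forall>t\<ge>0. Z t \<in> measurable M (count_space UNIV)) \<and>
     (\<forall>(s :: nat \<Rightarrow> real) (x :: nat \<Rightarrow> 'n) m.
        0 \<le> s 0 \<and> (\<forall>k\<le>m. s k \<le> s (Suc k)) \<longrightarrow>
        measure M {w \<in> space M. \<forall>k\<le>Suc m. Z (s k) w = x k} =
        measure M {w \<in> space M. \<forall>k\<le>m. Z (s k) w = x k} * T (s (Suc m) - s m) $ x m $ x (Suc m))"

definition heat_diffusion ::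
  "'n::finite pair_pre_digraph \<Rightarrow> 'n pmf \<Rightarrow> 'w measure \<Rightarrow> (real \<Rightarrow> 'w \<Rightarrow> 'n) \<Rightarrow> bool" where
  "heat_diffusion G p M Z \<longleftrightarrow>
     homogeneous_markov_chain M Z (heat_kernel G) \<and>
     distr M (count_space UNIV) (Z 0) = measure_pmf p"

text \<open>
  The entropy of the row \<open>i\<close> of a transition matrix; \<open>0 * ln 0 = 0\<close> holds because of the factor \<open>0\<close>.
\<close>

definition row_entropy :: "real ^ 'n ^ 'n \<Rightarrow> 'n::finite \<Rightarrow> real" where
  "row_entropy A i = - (\<Sum>j\<in>UNIV. A $ i $ j * ln (A $ i $ j))"

text \<open>\<open>H(Z(t) | Z(0))\<close> for a chain \<open>Z\<close> with transition matrices \<open>T\<close>.\<close>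

definition cond_entropy ::
  "'w measure \<Rightarrow> (real \<Rightarrow> 'w \<Rightarrow> 'n::finite) \<Rightarrow> (real \<Rightarrow> real ^ 'n ^ 'n) \<Rightarrow> real \<Rightarrow> real" where
  "cond_entropy M Z T t =
     (\<Sum>i\<in>UNIV. measure M {w \<in> space M. Z 0 w = i} * row_entropy (T t) i)"

end

theory Submission
  imports Defs "HOL-Real_Asymp.Real_Asymp"
begin

text \<open>
  The theorem is the statement that heat equilibrates within each connected component: as
  \<open>t \<rightarrow> \<infinity>\<close>, the row of the heat kernel at a node \<open>i\<close> tends to the uniform distribution on the
  component \<open>C\<close> of \<open>i\<close> (\<open>heat_kernel_tendsto\<close>).  Since \<open>x ln x\<close> is continuous, also at \<open>0\<close>, the
  entropy of the row then tends to \<open>ln |C|\<close>, and the conditional entropy is the average of the row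
  entropies over the initial distribution; grouping the nodes by components gives the formula.

  Equilibration is proved by an energy argument, without diagonalising the Laplacian \<open>L\<close>.  Let
  \<open>v t\<close> be the difference between column \<open>j\<close> of the heat kernel and the uniform distribution on the
  component of \<open>j\<close>.  Vectors that are constant on components lie in the kernel of \<open>L\<close>, so \<open>v\<close>
  solves the heat equation \<open>v' = - L v\<close>; and as \<open>L\<close> is symmetric, the total of \<open>v t\<close> over each
  component is conserved, hence zero as it is at time \<open>0\<close>.  On the space of vectors with zero
  component sums the quadratic form of \<open>L\<close>, which is the sum of \<open>(x i - x j)\<^sup>2\<close> over the edges, is
  bounded below by a positive multiple of the squared norm (\<open>spectral_gap\<close>): it is positive on the
  unit sphere of that space, because it vanishes only on vectors that are constant on components,
  and the sphere is compact.  Therefore the squared norm of \<open>v t\<close> decays exponentially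
  (\<open>spectral_gap_imp_decay\<close>).
\<close>

section \<open>The matrix exponential\<close>

lemma matrix_power_0 [simp]: "matrix_power A 0 = mat 1"
  by (simp add: matrix_power_def)

lemma matrix_power_Suc [simp]: "matrix_power A (Suc k) = A ** matrix_power A k"
  by (simp add: matrix_power_def)

lemma matrix_power_scaleR:
  fixes A :: "real ^ 'n::finite ^ 'n"
  shows "matrix_power (c *\<^sub>R A) k = c ^ k *\<^sub>R matrix_power A k"
  by (induction k)
     (simp_all add: vec_eq_iff matrix_matrix_mult_def sum_distrib_left mult_ac)

text \<open>
  The sum of all absolute values of the entries is used in place of a matrix norm: a crude
  geometric bound on the entries is enough to compare their series with the exponential series.
\<close>

lemma abs_matrix_power_entry_le:
  fixes A :: "real ^ 'n::finite ^ 'n"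
  shows "\<bar>matrix_power A k $ i $ j\<bar> \<le> (\<Sum>a\<in>UNIV. \<Sum>b\<in>UNIV. \<bar>A $ a $ b\<bar>) ^ k"
proof (induction k arbitrary: i)
  case 0
  then show ?case by (simp add: mat_def)
next
  case (Suc k)
  let ?c = "\<Sum>a\<in>UNIV. \<Sum>b\<in>UNIV. \<bar>A $ a $ b\<bar>"
  have "\<bar>matrix_power A (Suc k) $ i $ j\<bar> \<le> (\<Sum>l\<in>UNIV. \<bar>A $ i $ l\<bar> * \<bar>matrix_power A k $ l $ j\<bar>)"
    unfolding matrix_power_Suc matrix_matrix_mult_def
    by (simp flip: abs_mult)
  also have "\<dots> \<le> (\<Sum>l\<in>UNIV. \<bar>A $ i $ l\<bar> * ?c ^ k)"
    by (intro sum_mono mult_left_mono Suc.IH) simp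
  also have "\<dots> = (\<Sum>l\<in>UNIV. \<bar>A $ i $ l\<bar>) * ?c ^ k"
    by (simp add: sum_distrib_right)
  also have "\<dots> \<le> ?c * ?c ^ k"
    by (intro mult_right_mono zero_le_power sum_nonneg
          member_le_sum[of i UNIV "\<lambda>a. \<Sum>b\<in>UNIV. \<bar>A $ a $ b\<bar>"]) (auto intro: sum_nonneg)
  finally show ?case by simp
qed

lemma summable_matrix_exp_entry:
  fixes A :: "real ^ 'n::finite ^ 'n"
  shows "summable (\<lambda>k. matrix_power A k $ i $ j / fact k * t ^ k)"
proof (rule summable_comparison_test', rule summable_exp)
  fix k
  let ?c = "\<Sum>a\<in>UNIV. \<Sum>b\<in>UNIV. \<bar>A $ a $ b\<bar>"
  have "\<bar>matrix_power A k $ i $ j\<bar> * \<bar>t\<bar> ^ k \<le> ?c ^ k * \<bar>t\<bar> ^ k"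
    by (intro mult_right_mono abs_matrix_power_entry_le) simp
  then show "norm (matrix_power A k $ i $ j / fact k * t ^ k) \<le> inverse (fact k) * (?c * \<bar>t\<bar>) ^ k"
    by (simp add: abs_mult power_abs power_mult_distrib field_simps)
qed

lemma matrix_exp_scaleR_entry:
  fixes A :: "real ^ 'n::finite ^ 'n"
  shows "matrix_exp (t *\<^sub>R A) $ i $ j = (\<Sum>k. matrix_power A k $ i $ j / fact k * t ^ k)"
proof -
  let ?S = "\<chi> i j. \<Sum>k. matrix_power A k $ i $ j / fact k * t ^ k"
  have "(\<lambda>k. (1 / fact k) *\<^sub>R matrix_power (t *\<^sub>R A) k) sums ?S"
    unfolding sums_def
  proof (intro vec_tendstoI)
    fix i j
    show "(\<lambda>n. (\<Sum>k<n. (1 / fact k) *\<^sub>R matrix_power (t *\<^sub>R A) k) $ i $ j) \<longlonglongrightarrow> ?S $ i $ j"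
      using summable_LIMSEQ[OF summable_matrix_exp_entry[of A i j t]]
      by (simp add: matrix_power_scaleR mult_ac)
  qed
  then show ?thesis
    by (simp add: matrix_exp_def sums_unique[symmetric])
qed

text \<open>
  The entries of \<open>exp (t A)\<close> are everywhere convergent power series in \<open>t\<close>, and differentiating such
  a series termwise shifts its coefficients, that is, multiplies by \<open>A\<close>.
\<close>

lemma matrix_exp_entry_has_derivative:
  fixes A :: "real ^ 'n::finite ^ 'n"
  shows "((\<lambda>t. matrix_exp (t *\<^sub>R A) $ i $ j) has_field_derivative
           (A ** matrix_exp (t *\<^sub>R A)) $ i $ j) (at t)"
proof -
  define c where "c = (\<lambda>i k. matrix_power A k $ i $ j / fact k)"
  have summ: "summable (\<lambda>k. c i k * s ^ k)" for i s
    unfolding c_def by (rule summable_matrix_exp_entry)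
  have diffs: "diffs (c i) k * t ^ k = (\<Sum>l\<in>UNIV. A $ i $ l * (c l k * t ^ k))" for k
  proof -
    have "diffs (c i) k = matrix_power A (Suc k) $ i $ j / fact k"
      by (simp add: diffs_def c_def del: matrix_power_Suc of_nat_Suc)
    then show ?thesis
      by (simp add: c_def matrix_matrix_mult_def sum_distrib_left sum_divide_distrib mult_ac)
  qed
  have "((\<lambda>t. \<Sum>k. c i k * t ^ k) has_field_derivative (\<Sum>k. diffs (c i) k * t ^ k)) (at t)"
    by (intro termdiffs_strong_converges_everywhere summ)
  moreover have "(\<Sum>k. diffs (c i) k * t ^ k) = (\<Sum>l\<in>UNIV. A $ i $ l * (\<Sum>k. c l k * t ^ k))"
    unfolding diffs by (simp add: suminf_sum suminf_mult summable_mult summ)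
  ultimately show ?thesis
    by (simp add: matrix_exp_scaleR_entry c_def matrix_matrix_mult_def)
qed

lemma matrix_exp_0: "matrix_exp (0 :: real ^ 'n::finite ^ 'n) = mat 1"
proof -
  have "matrix_exp (0 *\<^sub>R (mat 1 :: real ^ 'n ^ 'n)) $ i $ j = (mat 1 :: real ^ 'n ^ 'n) $ i $ j" for i j
    unfolding matrix_exp_scaleR_entry
    by (subst powser_zero) simp
  then show ?thesis by (simp add: vec_eq_iff)
qed

section \<open>Exponential decay under a spectral gap\<close>

text \<open>
  The inner product of \<open>v\<close> and \<open>v'\<close> is half the derivative of the squared norm of \<open>v\<close>, so the
  inequality makes \<open>exp (2 c t)\<close> times that squared norm nonincreasing.
\<close>

lemma spectral_gap_imp_decay:
  fixes v :: "real \<Rightarrow> 'a::real_inner"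
  assumes deriv: "\<And>t. (v has_vector_derivative v' t) (at t)"
    and gap: "\<And>t. v t \<bullet> v' t \<le> - c * (v t \<bullet> v t)"
    and "c > 0"
  shows "(v \<longlongrightarrow> 0) at_top"
proof -
  let ?E = "\<lambda>t. exp (2 * c * t) * (v t \<bullet> v t)"
  have "((\<lambda>t. v t \<bullet> v t) has_field_derivative 2 * (v t \<bullet> v' t)) (at t)" for t
    using bounded_bilinear.has_vector_derivative[OF bounded_bilinear_inner deriv deriv]
    by (simp add: has_real_derivative_iff_has_vector_derivative inner_commute)
  then have dE: "(?E has_field_derivative
       2 * exp (2 * c * t) * (v t \<bullet> v' t + c * (v t \<bullet> v t))) (at t)" for t
    by (auto intro!: derivative_eq_intros simp: algebra_simps)
  have "?E t \<le> ?E 0" if "t \<ge> 0" for t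
  proof (rule DERIV_nonpos_imp_nonincreasing[OF that])
    fix s
    show "\<exists>y. (?E has_real_derivative y) (at s) \<and> y \<le> 0"
      using dE[of s] gap[of s] by (force intro: mult_nonneg_nonpos)
  qed
  then have bound: "v t \<bullet> v t \<le> exp (- (2 * c * t)) * (v 0 \<bullet> v 0)" if "t \<ge> 0" for t
    using that by (force simp: exp_minus field_simps)
  have "((\<lambda>t. exp (- (2 * c * t))) \<longlongrightarrow> 0) at_top"
    using \<open>c > 0\<close> by real_asymp
  then have upper: "((\<lambda>t. exp (- (2 * c * t)) * (v 0 \<bullet> v 0)) \<longlongrightarrow> 0) at_top"
    by (rule tendsto_mult_left_zero)
  have "((\<lambda>t. v t \<bullet> v t) \<longlongrightarrow> 0) at_top"
  proof (rule tendsto_sandwich[OF _ _ tendsto_const upper])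
    show "\<forall>\<^sub>F t in at_top. 0 \<le> v t \<bullet> v t"
      by simp
    show "\<forall>\<^sub>F t in at_top. v t \<bullet> v t \<le> exp (- (2 * c * t)) * (v 0 \<bullet> v 0)"
      using bound by (rule eventually_at_top_linorderI)
  qed
  from tendsto_real_sqrt[OF this] show ?thesis
    by (simp add: tendsto_norm_zero_iff flip: norm_eq_sqrt_inner)
qed

section \<open>The Laplacian of a graph on all nodes of a finite type\<close>

locale spanning_pair_graph = pair_graph G for G :: "'n::finite pair_pre_digraph" +
  assumes pverts_UNIV: "pverts G = UNIV"
begin

lemma adj_sym: "(i, j) \<in> parcs G \<longleftrightarrow> (j, i) \<in> parcs G"
  using pair_sym_arcs by (auto simp: symmetric_def dest: symD)

text \<open>
  As there are no loops, the degree on the diagonal counts one copy of \<open>x $ i\<close> for each neighbour.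
\<close>

lemma laplacian_mult_vec:
  "(laplacian G *v x) $ i = (\<Sum>j | (i, j) \<in> parcs G. x $ i - x $ j)"
proof -
  have "out_arcs (with_proj G) i = Pair i ` {j. (i, j) \<in> parcs G}"
    by (auto simp: out_arcs_def)
  then have deg: "out_degree (with_proj G) i = card {j. (i, j) \<in> parcs G}"
    by (simp add: out_degree_def card_image inj_on_def)
  have noloop: "(i, i) \<notin> parcs G"
    using pair_no_loops by force
  have "(laplacian G *v x) $ i = (\<Sum>j\<in>UNIV. (if j = i then card {j. (i, j) \<in> parcs G} * x $ i else 0)
      - (if (i, j) \<in> parcs G then x $ j else 0))"
    unfolding matrix_vector_mult_def laplacian_def
    using noloop by (auto simp: deg intro!: sum.cong)
  also have "\<dots> = (\<Sum>j | (i, j) \<in> parcs G. x $ i - x $ j)"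
    by (simp add: sum_subtractf sum.If_cases)
  finally show ?thesis .
qed

lemma inner_laplacian_commute: "x \<bullet> (laplacian G *v y) = (laplacian G *v x) \<bullet> y"
proof -
  have "transpose (laplacian G) = laplacian G"
    by (auto simp: transpose_def laplacian_def vec_eq_iff adj_sym)
  then show ?thesis
    by (metis dot_lmul_matrix vector_transpose_matrix)
qed

text \<open>
  Each edge is represented by two arcs, whence the factor \<open>1/2\<close>.  Expanding the left-hand side gives
  a sum over arcs \<open>(i, j)\<close> of \<open>x i (x i - x j)\<close>; adding the same sum over the reversed arcs turns
  each term into a square.
\<close>

lemma dirichlet_form:
  "x \<bullet> (laplacian G *v x) = (\<Sum>(i, j)\<in>parcs G. (x $ i - x $ j)\<^sup>2) / 2"
proof -
  have E: "x \<bullet> (laplacian G *v x) = (\<Sum>(i, j)\<in>parcs G. x $ i * (x $ i - x $ j))"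
  proof -
    have "x \<bullet> (laplacian G *v x) = (\<Sum>i\<in>UNIV. \<Sum>j | (i, j) \<in> parcs G. x $ i * (x $ i - x $ j))"
      by (simp add: inner_vec_def laplacian_mult_vec sum_distrib_left)
    also have "\<dots> = (\<Sum>(i, j)\<in>(SIGMA i:UNIV. {j. (i, j) \<in> parcs G}). x $ i * (x $ i - x $ j))"
      by (subst sum.Sigma) auto
    also have "(SIGMA i:UNIV. {j. (i, j) \<in> parcs G}) = parcs G" by auto
    finally show ?thesis .
  qed
  also have "\<dots> = (\<Sum>(i, j)\<in>parcs G. x $ j * (x $ j - x $ i))"
    by (rule sum.reindex_bij_witness[of _ prod.swap prod.swap]) (auto simp: adj_sym)
  finally have E': "x \<bullet> (laplacian G *v x) = \<dots>" .
  have "2 * (x \<bullet> (laplacian G *v x)) =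
      (\<Sum>(i, j)\<in>parcs G. x $ i * (x $ i - x $ j)) + (\<Sum>(i, j)\<in>parcs G. x $ j * (x $ j - x $ i))"
    using E E' by simp
  also have "\<dots> = (\<Sum>(i, j)\<in>parcs G. (x $ i - x $ j)\<^sup>2)"
    by (simp add: split_def power2_eq_square algebra_simps flip: sum.distrib)
  finally show ?thesis by simp
qed

section \<open>Components and the spectral gap\<close>

lemma adj_scc_of_eq:
  assumes "(i, j) \<in> parcs G" shows "scc_of i = scc_of j"
  using assms by (intro scc_of_eq scc_ofI_reachable reachable_adjI)

lemma in_scc_of_refl [simp]: "i \<in> scc_of i"
  by (simp add: in_scc_of_self pverts_UNIV)

lemma scc_of_nonempty [simp]: "scc_of i \<noteq> {}"
  using in_scc_of_refl by blast

lemma in_scc_of_iff: "j \<in> scc_of i \<longleftrightarrow> scc_of j = scc_of i"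
  using in_scc_of_refl scc_of_eq by blast

lemma laplacian_component_constant:
  assumes "\<And>i j. scc_of i = scc_of j \<Longrightarrow> x $ i = x $ j"
  shows "laplacian G *v x = 0"
  by (auto simp: vec_eq_iff laplacian_mult_vec intro!: sum.neutral dest!: adj_scc_of_eq assms)

text \<open>
  A vanishing sum of squares makes the vector equal at the two ends of every edge, and therefore
  along every walk.
\<close>

lemma dirichlet_form_zero_imp_component_constant:
  assumes "x \<bullet> (laplacian G *v x) = 0" and "scc_of i = scc_of j"
  shows "x $ i = x $ j"
proof -
  have "(\<Sum>(i, j)\<in>parcs G. (x $ i - x $ j)\<^sup>2) = 0"
    using assms(1) by (simp add: dirichlet_form)
  then have edge: "x $ a = x $ b" if "(a, b) \<in> parcs G" for a b
    using that by (subst (asm) sum_nonneg_eq_0_iff) auto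
  have "i \<rightarrow>\<^sup>*\<^bsub>with_proj G\<^esub> j"
    using assms(2) in_scc_of_iff[of j i] by (auto simp only: scc_of_def mem_Collect_eq)
  then show ?thesis
    by (induction rule: reachable_induct) (auto dest: edge)
qed

text \<open>
  If the graph has an edge, the constant is the minimum of the quadratic form on the unit sphere of
  the space of vectors with zero component sums, that is, the least positive eigenvalue of the
  Laplacian.  The minimum is positive because a vector that is constant on components and has zero component sums is zero.
\<close>

lemma spectral_gap:
  obtains c where "c > 0"
    "\<And>x. (\<And>i. (\<Sum>j\<in>scc_of i. x $ j) = 0) \<Longrightarrow> c * (x \<bullet> x) \<le> x \<bullet> (laplacian G *v x)"
proof -
  define S where "S = sphere 0 1 \<inter> {x :: real ^ 'n. \<forall>i. (\<Sum>j\<in>scc_of i. x $ j) = 0}"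
  let ?Q = "\<lambda>x. x \<bullet> (laplacian G *v x)"
  have "compact S"
    unfolding S_def
    by (intro compact_Int_closed compact_sphere closed_Collect_all closed_Collect_eq continuous_intros)
  have cont: "continuous_on S ?Q"
    by (intro continuous_intros linear_continuous_on matrix_vector_mul_bounded_linear)
  have pos: "?Q x > 0" if "x \<in> S" for x
  proof -
    have "?Q x \<ge> 0"
      by (auto simp: dirichlet_form intro!: sum_nonneg)
    moreover have "?Q x \<noteq> 0"
    proof
      assume "?Q x = 0"
      have "x $ i = 0" for i
      proof -
        have "(\<Sum>j\<in>scc_of i. x $ j) = (\<Sum>j\<in>scc_of i. x $ i)"
          by (intro sum.cong dirichlet_form_zero_imp_component_constant[OF \<open>?Q x = 0\<close>])
             (simp_all add: in_scc_of_iff)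
        then show ?thesis
          using that by (simp add: S_def)
      qed
      then have "x = 0" by (simp add: vec_eq_iff)
      with that show False by (simp add: S_def)
    qed
    ultimately show ?thesis by simp
  qed
  obtain c where "c > 0" and c: "\<And>x. x \<in> S \<Longrightarrow> c \<le> ?Q x"
  \<comment> \<open>The sphere is empty when the graph has no edges; then any constant will do.\<close>
  proof (cases "S = {}")
    case True
    then show ?thesis using that[of 1] by simp
  next
    case False
    then show ?thesis
      using continuous_attains_inf[OF \<open>compact S\<close> False cont] pos that by metis
  qed
  show ?thesis
  proof (rule that[OF \<open>c > 0\<close>])
    fix x :: "real ^ 'n"
    assume x: "\<And>i. (\<Sum>j\<in>scc_of i. x $ j) = 0"
    show "c * (x \<bullet> x) \<le> ?Q x"
    proof (cases "x = 0")
      case False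
      have "(1 / norm x) *\<^sub>R x \<in> S"
        using False x by (simp add: S_def flip: sum_divide_distrib)
      from c[OF this] show ?thesis
        using False
        by (simp add: matrix_vector_mult_scaleR dot_square_norm power2_eq_square field_simps)
    qed simp
  qed
qed

section \<open>Long-time limits\<close>

text \<open>
  The columns of the heat kernel, rather than its rows, solve the heat equation in the form given by
  differentiating the exponential.  The limit does not see the difference, because lying in the
  same component is a symmetric relation.
\<close>

theorem heat_kernel_tendsto:
  "((\<lambda>t. heat_kernel G t $ i $ j) \<longlongrightarrow>
     (if j \<in> scc_of i then 1 / card (scc_of i) else 0)) at_top"
proof -
  let ?L = "laplacian G"
  define h :: "real ^ 'n" where "h = (\<chi> i. if j \<in> scc_of i then 1 / card (scc_of i) else 0)"
  define v where "v = (\<lambda>t. column j (heat_kernel G t) - h)"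
  obtain c where "c > 0"
    and c: "\<And>x. (\<And>i. (\<Sum>j\<in>scc_of i. x $ j) = 0) \<Longrightarrow> c * (x \<bullet> x) \<le> x \<bullet> (?L *v x)"
    using spectral_gap by blast
  have Lh: "?L *v h = 0"
    by (rule laplacian_component_constant) (simp add: h_def)
  have hk: "heat_kernel G t = matrix_exp (t *\<^sub>R (- ?L))" for t
    by (simp add: heat_kernel_def)
  have "((\<lambda>t. v t $ i) has_field_derivative (- (?L *v v t)) $ i) (at t)" for t i
  proof -
    have "(- (?L *v v t)) $ i = (- ?L ** heat_kernel G t) $ i $ j"
      unfolding v_def matrix_vector_mult_diff_distrib Lh
      by (simp add: matrix_vector_mult_def matrix_matrix_mult_def column_def sum_negf)
    then show ?thesis
      using matrix_exp_entry_has_derivative[of "- ?L" i j t]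
      by (auto simp: v_def column_def hk intro!: derivative_eq_intros)
  qed
  then have deriv: "(v has_vector_derivative - (?L *v v t)) (at t)" for t
    unfolding has_real_derivative_iff_has_vector_derivative has_vector_derivative_def
    by (subst has_derivative_componentwise_within) (simp add: Basis_vec_def inner_axis)
  \<comment> \<open>Conservation of heat in each component: its indicator vector is in the kernel of the
    symmetric matrix \<open>?L\<close>.\<close>
  have mass: "(\<Sum>j\<in>scc_of i. v t $ j) = 0" for i t
  proof -
    define u :: "real ^ 'n" where "u = (\<chi> k. if k \<in> scc_of i then 1 else 0)"
    have Lu: "?L *v u = 0"
      by (rule laplacian_component_constant) (simp add: u_def in_scc_of_iff)
    have u: "u \<bullet> x = (\<Sum>j\<in>scc_of i. x $ j)" for x
      by (simp add: inner_vec_def u_def if_distrib[of "\<lambda>x. x * _"] sum.If_cases cong: if_cong)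
    have "((\<lambda>t. u \<bullet> v t) has_field_derivative 0) (at t)" for t
      using bounded_linear.has_vector_derivative[OF bounded_linear_inner_right deriv, of u t]
      by (simp add: has_real_derivative_iff_has_vector_derivative inner_laplacian_commute Lu)
    then have "u \<bullet> v t = u \<bullet> v 0"
      using DERIV_isconst_all by blast
    also have "v 0 = column j (mat 1) - h"
      by (simp add: v_def heat_kernel_def matrix_exp_0)
    also have "u \<bullet> \<dots> = 0"
    proof (cases "j \<in> scc_of i")
      case True
      have "(\<Sum>k\<in>scc_of i. h $ k) = (\<Sum>k\<in>scc_of i. 1 / card (scc_of i))"
        using True by (intro sum.cong) (auto simp: h_def in_scc_of_iff)
      also have "\<dots> = 1"
        by simp
      finally show ?thesis
        using True by (simp add: u column_def mat_def sum_subtractf)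
    next
      case False
      then have "(\<Sum>k\<in>scc_of i. h $ k) = 0" "(\<Sum>k\<in>scc_of i. if k = j then 1 else 0) = (0::real)"
        by (auto simp: h_def in_scc_of_iff)
      then show ?thesis
        by (simp add: u column_def mat_def sum_subtractf)
    qed
    finally show ?thesis by (simp add: u)
  qed
  have "(v \<longlongrightarrow> 0) at_top"
    using c[of "v _", OF mass] by (intro spectral_gap_imp_decay[OF deriv _ \<open>c > 0\<close>]) simp
  from tendsto_add[OF tendsto_vec_nth[OF this, of i] tendsto_const[of "h $ i"]] show ?thesis
    by (simp add: v_def column_def h_def)
qed

text \<open>
  The logarithm of a negative number is that of its absolute value, so \<open>x ln x\<close> is an odd function
  and tends to \<open>0\<close> from both sides of \<open>0\<close>; at all other points \<^term>\<open>ln\<close> itself is continuous.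
\<close>

lemma tendsto_mult_ln_self:
  fixes f :: "'b \<Rightarrow> real"
  assumes "(f \<longlongrightarrow> a) F"
  shows "((\<lambda>x. f x * ln (f x)) \<longlongrightarrow> a * ln a) F"
proof (cases "a = 0")
  case True
  have right: "((\<lambda>x::real. x * ln x) \<longlongrightarrow> 0) (at_right 0)"
    by real_asymp
  then have "((\<lambda>x::real. x * ln x) \<longlongrightarrow> 0) (at_left 0)"
    using tendsto_minus[OF right] by (simp add: filterlim_at_left_to_right ln_minus)
  with right have "isCont (\<lambda>x::real. x * ln x) 0"
    by (simp add: isCont_def filterlim_split_at)
  then show ?thesis
    using True assms isCont_tendsto_compose by fastforce
next
  case False
  with assms show ?thesis by (intro tendsto_intros)
qed

lemma row_entropy_heat_kernel_tendsto:
  "((\<lambda>t. row_entropy (heat_kernel G t) i) \<longlongrightarrow> ln (card (scc_of i))) at_top"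
proof -
  let ?h = "\<lambda>j. if j \<in> scc_of i then 1 / real (card (scc_of i)) else 0"
  have "card (scc_of i) > 0"
    by (simp add: card_gt_0_iff)
  have "((\<lambda>t. row_entropy (heat_kernel G t) i) \<longlongrightarrow> - (\<Sum>j\<in>UNIV. ?h j * ln (?h j))) at_top"
    unfolding row_entropy_def
    by (intro tendsto_minus tendsto_sum tendsto_mult_ln_self heat_kernel_tendsto)
  also have "(\<Sum>j\<in>UNIV. ?h j * ln (?h j)) = (\<Sum>j\<in>scc_of i. 1 / card (scc_of i) * ln (1 / card (scc_of i)))"
    by (intro sum.mono_neutral_cong_right) auto
  also have "- \<dots> = ln (card (scc_of i))"
    using \<open>card (scc_of i) > 0\<close> by (simp add: ln_div)
  finally show ?thesis .
qed

lemma cond_entropy_tendsto: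
  assumes "heat_diffusion G p M Z"
  shows "((\<lambda>t. cond_entropy M Z (heat_kernel G) t) \<longlongrightarrow>
           (\<Sum>i\<in>UNIV. pmf p i * ln (card (scc_of i)))) at_top"
proof -
  have "\<forall>t\<ge>0. Z t \<in> measurable M (count_space UNIV)"
    and distr: "distr M (count_space UNIV) (Z 0) = measure_pmf p"
    using assms unfolding heat_diffusion_def homogeneous_markov_chain_def by blast+
  then have Z0: "Z 0 \<in> measurable M (count_space UNIV)"
    by blast
  have "measure M {w \<in> space M. Z 0 w = i} = pmf p i" for i
  proof -
    have "pmf p i = measure (distr M (count_space UNIV) (Z 0)) {i}"
      by (simp add: distr pmf.rep_eq)
    also have "\<dots> = measure M {w \<in> space M. Z 0 w = i}"
      by (subst measure_distr[OF Z0]) (auto intro!: arg_cong[where f = "measure M"])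
    finally show ?thesis by simp
  qed
  then show ?thesis
    unfolding cond_entropy_def
    by (auto intro!: tendsto_intros row_entropy_heat_kernel_tendsto)
qed

lemma sum_over_components:
  fixes f :: "'n \<Rightarrow> real"
  assumes "bij_betw V I sccs_verts"
  shows "(\<Sum>i\<in>UNIV. f i * g (scc_of i)) = (\<Sum>k\<in>I. g (V k) * (\<Sum>j\<in>V k. f j))"
proof -
  have sccs: "sccs_verts = range scc_of"
    by (simp add: sccs_verts_conv_scc_of pverts_UNIV)
  have "(\<Sum>i\<in>UNIV. f i * g (scc_of i)) = (\<Sum>C\<in>sccs_verts. \<Sum>i | scc_of i = C. f i * g (scc_of i))"
    unfolding sccs using sum.group[of UNIV "range scc_of" scc_of "\<lambda>i. f i * g (scc_of i)"] by simp
  also have "\<dots> = (\<Sum>C\<in>sccs_verts. g C * (\<Sum>i\<in>C. f i))"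
  proof (rule sum.cong)
    fix C assume "C \<in> sccs_verts"
    then obtain i where "C = scc_of i"
      unfolding sccs by blast
    then have "{i. scc_of i = C} = C"
      using in_scc_of_iff by blast
    moreover have "(\<Sum>i | scc_of i = C. f i * g (scc_of i)) = g C * (\<Sum>i | scc_of i = C. f i)"
      by (simp add: sum_distrib_left mult.commute)
    ultimately show "(\<Sum>i | scc_of i = C. f i * g (scc_of i)) = g C * (\<Sum>i\<in>C. f i)"
      by simp
  qed simp
  also have "\<dots> = (\<Sum>k\<in>I. g (V k) * (\<Sum>j\<in>V k. f j))"
    by (rule sum.reindex_bij_betw[OF assms, symmetric])
  finally show ?thesis .
qed

end

theorem proposition3p10:
  fixes G :: "'n::finite pair_pre_digraph"
    and V :: "nat \<Rightarrow> 'n set"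
    and l :: nat
    and p :: "'n pmf"
    and M :: "'w measure"
    and Z :: "real \<Rightarrow> 'w \<Rightarrow> 'n"
  assumes "pair_graph G"
    and "pverts G = UNIV"
    and "bij_betw V {1..l} (pre_digraph.sccs_verts (with_proj G))"
    and "heat_diffusion G p M Z"
  shows "((\<lambda>t. cond_entropy M Z (heat_kernel G) t) \<longlongrightarrow>
           (\<Sum>k=1..l. ln (real (card (V k))) * (\<Sum>j\<in>V k. pmf p j))) at_top
       \<and> (p = pmf_of_set (pverts G) \<longrightarrow>
           ((\<lambda>t. cond_entropy M Z (heat_kernel G) t) \<longlongrightarrow>
             (\<Sum>i=1..l. real (card (V i)) / real (card (pverts G)) * ln (real (card (V i))))) at_top)"
proof -
  interpret spanning_pair_graph G
    using assms(1,2) by (simp add: spanning_pair_graph_def spanning_pair_graph_axioms_def)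
  have "((\<lambda>t. cond_entropy M Z (heat_kernel G) t) \<longlongrightarrow>
           (\<Sum>k=1..l. ln (real (card (V k))) * (\<Sum>j\<in>V k. pmf p j))) at_top"
    using cond_entropy_tendsto[OF assms(4)]
    unfolding sum_over_components[OF assms(3), where g = "\<lambda>C. ln (card C)"] .
  moreover have "(\<Sum>k=1..l. ln (real (card (V k))) * (\<Sum>j\<in>V k. pmf p j)) =
      (\<Sum>i=1..l. real (card (V i)) / real (card (pverts G)) * ln (real (card (V i))))"
    if "p = pmf_of_set (pverts G)"
    by (simp add: that assms(2) mult.commute)
  ultimately show ?thesis
    by metis
qed

end
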